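(* Let $S$ be a commutative semiring in which every multiplicative idempotent is complemented. Then the following are equivalent: (i) $S$ is von Neumann regular; (ii) every ideal of $S$ is an intersection of maximal ideals containing it, i.e. $I=\bigcap\{M\in\mathrm{Max}(S)\mid I\subseteq M\}$ for every ideal $I$ of $S$; (iii) every ideal of $S$ is a $z$-ideal; (iv) every principal ideal of $S$ is a $z$-ideal.
   Context: A semiring here is commutative with $0$ and $1$: $(S,+,0)$ and $(S,\cdot,1)$ are commutative monoids, multiplication distributes over addition, and $0s=0$ for all $s\in S$. An ideal of $S$ is a non-empty subset closed under addition and under multiplication by arbitrary elements of $S$. Maximal ideals are proper; $\mathrm{Max}(S)$ is the set of maximal ideals of $S$. The intersection over an empty family of ideals is $S$. For $a\in S$ put $\mathcal M(a)=\{M\in\mathrm{Max}(S)\mid a\in M\}$. An ideal $I$ is a $z$-ideal if, whenever $a\in I$ and $b\in S$ satisfy $\mathcal M(a)=\mathcal M(b)$, one has $b\in I$. $S$ is von Neumann regular if for every $a\in S$ there exists $x\in S$ with $a=a^2x$. A multiplicative idempotent is an element $e$ with $e^2=e$; it is complemented if there is an idempotent $f\in S$ with $ef=0$ and $e+f=1$. *)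

theory Defs
  imports Main
begin

text \<open>
  A commutative semiring with 0 and 1 is a type of sort
  \<open>{comm_semiring_0, comm_monoid_mult}\<close>. The class \<open>comm_semiring_1\<close> is not used since it
  additionally requires \<open>0 \<noteq> 1\<close>, which would exclude the trivial semiring.
\<close>

definition semiring_ideal :: "'a::{comm_semiring_0, comm_monoid_mult} set \<Rightarrow> bool" where
  "semiring_ideal I \<longleftrightarrow>
     I \<noteq> {} \<and> (\<forall>a\<in>I. \<forall>b\<in>I. a + b \<in> I) \<and> (\<forall>s. \<forall>a\<in>I. s * a \<in> I)"

definition maximal_ideal :: "'a::{comm_semiring_0, comm_monoid_mult} set \<Rightarrow> bool" where
  "maximal_ideal M \<longleftrightarrow>
     semiring_ideal M \<and> M \<noteq> UNIV \<and>
     (\<forall>J. semiring_ideal J \<and> M \<subseteq> J \<longrightarrow> J = M \<or> J = UNIV)"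

definition Max_spec :: "'a::{comm_semiring_0, comm_monoid_mult} set set" where
  "Max_spec = {M. maximal_ideal M}"

definition max_ideals_containing ::
    "'a::{comm_semiring_0, comm_monoid_mult} \<Rightarrow> 'a set set" where
  "max_ideals_containing a = {M \<in> Max_spec. a \<in> M}"

definition z_ideal :: "'a::{comm_semiring_0, comm_monoid_mult} set \<Rightarrow> bool" where
  "z_ideal I \<longleftrightarrow>
     semiring_ideal I \<and>
     (\<forall>a b. a \<in> I \<and> max_ideals_containing a = max_ideals_containing b \<longrightarrow> b \<in> I)"

definition principal_ideal :: "'a::{comm_semiring_0, comm_monoid_mult} \<Rightarrow> 'a set" where
  "principal_ideal a = {s * a | s. True}"

definition von_neumann_regular :: "'a::{comm_semiring_0, comm_monoid_mult} itself \<Rightarrow> bool" where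
  "von_neumann_regular _ \<longleftrightarrow> (\<forall>a::'a. \<exists>x. a = a\<^sup>2 * x)"

definition mult_idempotent :: "'a::{comm_semiring_0, comm_monoid_mult} \<Rightarrow> bool" where
  "mult_idempotent e \<longleftrightarrow> e\<^sup>2 = e"

definition complemented :: "'a::{comm_semiring_0, comm_monoid_mult} \<Rightarrow> bool" where
  "complemented e \<longleftrightarrow> (\<exists>f. mult_idempotent f \<and> e * f = 0 \<and> e + f = 1)"

end

theory Submission
  imports Defs
begin

text \<open>
  If \<open>a = a\<^sup>2 x\<close>, then \<open>e = a x\<close> is an idempotent generating the same ideal as \<open>a\<close>. When
  \<open>a \<notin> I\<close>, the complement \<open>f\<close> of \<open>e\<close> generates together with \<open>I\<close> a proper ideal, because
  \<open>1 = i + s f\<close> would give \<open>e = e i \<in> I\<close>; a maximal ideal above it contains \<open>I\<close> but not \<open>a\<close>.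
  Conversely, no maximal ideal separates \<open>a\<close> from \<open>a\<^sup>2\<close>, so if \<open>(a\<^sup>2)\<close> is a \<open>z\<close>-ideal then
  \<open>a \<in> (a\<^sup>2)\<close>.
\<close>

lemma semiring_idealD:
  fixes I :: "'a::{comm_semiring_0, comm_monoid_mult} set"
  assumes "semiring_ideal I"
  shows semiring_ideal_add: "a \<in> I \<Longrightarrow> b \<in> I \<Longrightarrow> a + b \<in> I"
    and semiring_ideal_mult: "a \<in> I \<Longrightarrow> s * a \<in> I"
    and semiring_ideal_mult_right: "a \<in> I \<Longrightarrow> a * s \<in> I"
    and semiring_ideal_zero: "0 \<in> I"
proof -
  show *: "a \<in> I \<Longrightarrow> s * a \<in> I" for a s
    using assms by (simp add: semiring_ideal_def)
  then show "a \<in> I \<Longrightarrow> a * s \<in> I"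
    by (metis mult.commute)
  show "a \<in> I \<Longrightarrow> b \<in> I \<Longrightarrow> a + b \<in> I"
    using assms by (simp add: semiring_ideal_def)
  \<comment> \<open>Ideals are only required to be non-empty, so \<open>0\<close> has to be produced
    as \<open>0 * c\<close>.\<close>
  obtain c where "c \<in> I"
    using assms by (auto simp: semiring_ideal_def)
  then show "0 \<in> I"
    using *[of c 0] by simp
qed

lemma semiring_ideal_UNIV_iff:
  fixes I :: "'a::{comm_semiring_0, comm_monoid_mult} set"
  assumes "semiring_ideal I"
  shows "I = UNIV \<longleftrightarrow> 1 \<in> I"
  using semiring_ideal_mult[OF assms, of 1] by auto

lemma semiring_ideal_principal: "semiring_ideal (principal_ideal a)"
  unfolding semiring_ideal_def principal_ideal_def
  by (auto simp: distrib_right[symmetric] mult.assoc[symmetric])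

text \<open>This is the ideal generated by \<open>I\<close> and \<open>a\<close>. It serves twice:
  to enlarge a maximal ideal by an element outside it, and to adjoin the complement of an idempotent
  to a given ideal.\<close>

lemma semiring_ideal_add_principal:
  fixes I :: "'a::{comm_semiring_0, comm_monoid_mult} set"
  assumes "semiring_ideal I"
  shows "semiring_ideal {i + s * a | i s. i \<in> I}"
  unfolding semiring_ideal_def
proof (intro conjI ballI allI)
  show "{i + s * a | i s. i \<in> I} \<noteq> {}"
    using semiring_ideal_zero[OF assms] by auto
next
  fix x y assume "x \<in> {i + s * a | i s. i \<in> I}" "y \<in> {i + s * a | i s. i \<in> I}"
  then obtain i s j t where "x = i + s * a" "i \<in> I" "y = j + t * a" "j \<in> I" by blast
  moreover have "(i + s * a) + (j + t * a) = (i + j) + (s + t) * a"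
    by (simp add: algebra_simps)
  ultimately show "x + y \<in> {i + s * a | i s. i \<in> I}"
    using semiring_ideal_add[OF assms] by blast
next
  fix r x assume "x \<in> {i + s * a | i s. i \<in> I}"
  then obtain i s where "x = i + s * a" "i \<in> I" by blast
  moreover have "r * (i + s * a) = r * i + (r * s) * a"
    by (simp add: algebra_simps)
  ultimately show "r * x \<in> {i + s * a | i s. i \<in> I}"
    using semiring_ideal_mult[OF assms] by blast
qed

lemma add_principal_superset:
  fixes I :: "'a::{comm_semiring_0, comm_monoid_mult} set"
  assumes "semiring_ideal I"
  shows "I \<subseteq> {i + s * a | i s. i \<in> I}" "a \<in> {i + s * a | i s. i \<in> I}"
proof -
  have "x = x + 0 * a" for x by simp
  then show "I \<subseteq> {i + s * a | i s. i \<in> I}" by blast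
  have "a = 0 + 1 * a" by simp
  then show "a \<in> {i + s * a | i s. i \<in> I}"
    using semiring_ideal_zero[OF assms] by blast
qed

lemma semiring_ideal_Union_chain:
  assumes "C \<noteq> {}" "subset.chain {J. semiring_ideal J} C"
  shows "semiring_ideal (\<Union>C)"
  unfolding semiring_ideal_def
proof (intro conjI ballI allI)
  have ideal: "semiring_ideal J" if "J \<in> C" for J
    using assms(2) that by (auto simp: subset_chain_def)
  show "\<Union>C \<noteq> {}"
    using assms(1) ideal semiring_ideal_zero by blast
  fix a assume "a \<in> \<Union>C"
  then obtain A where A: "A \<in> C" "a \<in> A" by blast
  show "s * a \<in> \<Union>C" for s
    using A ideal semiring_ideal_mult by blast
  fix b assume "b \<in> \<Union>C"
  then obtain B where B: "B \<in> C" "b \<in> B" by blast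
  have "A \<subseteq> B \<or> B \<subseteq> A"
    using assms(2) A B by (auto simp: subset_chain_def)
  then show "a + b \<in> \<Union>C"
    using A B ideal semiring_ideal_add by blast
qed

text \<open>Krull's argument by Zorn's lemma. Properness is phrased as \<open>1 \<notin> J\<close>
  because this condition visibly passes to unions of chains.\<close>

lemma exists_maximal_ideal_superset:
  fixes I :: "'a::{comm_semiring_0, comm_monoid_mult} set"
  assumes I: "semiring_ideal I" "1 \<notin> I"
  shows "\<exists>M\<in>Max_spec. I \<subseteq> M"
proof -
  define \<A> where "\<A> = {J. semiring_ideal J \<and> I \<subseteq> J \<and> 1 \<notin> J}"
  have "\<exists>M\<in>\<A>. \<forall>X\<in>\<A>. M \<subseteq> X \<longrightarrow> X = M"
  proof (rule subset_Zorn_nonempty)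
    show "\<A> \<noteq> {}" using I by (auto simp: \<A>_def)
    fix C assume C: "C \<noteq> {}" "subset.chain \<A> C"
    then have "subset.chain {J. semiring_ideal J} C"
      by (auto simp: subset_chain_def \<A>_def)
    with C show "\<Union>C \<in> \<A>"
      using semiring_ideal_Union_chain[of C] by (auto simp: subset_chain_def \<A>_def)
  qed
  then obtain M where M: "M \<in> \<A>" "\<And>X. X \<in> \<A> \<Longrightarrow> M \<subseteq> X \<Longrightarrow> X = M" by blast
  \<comment> \<open>An ideal \<open>J\<close> above \<open>M\<close> contains \<open>I\<close> as
    well, so it either lies in \<open>\<A>\<close>, where \<open>M\<close> is maximal, or contains
    \<open>1\<close>.\<close>
  have "J = M \<or> J = UNIV" if "semiring_ideal J" "M \<subseteq> J" for J
    using M(1) M(2)[of J] that semiring_ideal_UNIV_iff[OF that(1)] by (auto simp: \<A>_def)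
  then have "maximal_ideal M"
    using M(1) unfolding maximal_ideal_def \<A>_def by blast
  then show ?thesis
    using M(1) by (auto simp: Max_spec_def \<A>_def)
qed

text \<open>The usual proof that maximal ideals are prime, in the special case of a square: it needs
  no subtraction, since adjoining \<open>a\<close> to \<open>M\<close> yields
  \<open>1 = i + s * a\<close>.\<close>

lemma maximal_ideal_power2_iff:
  assumes "maximal_ideal M"
  shows "a\<^sup>2 \<in> M \<longleftrightarrow> a \<in> M"
proof
  have M: "semiring_ideal M" using assms by (simp add: maximal_ideal_def)
  show "a\<^sup>2 \<in> M" if "a \<in> M"
    using semiring_ideal_mult[OF M that] by (simp add: power2_eq_square)
  assume a2: "a\<^sup>2 \<in> M"
  show "a \<in> M"
  proof (rule ccontr)
    assume "a \<notin> M"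
    let ?J = "{i + s * a | i s. i \<in> M}"
    have "?J \<noteq> M"
      using add_principal_superset(2)[OF M, of a] \<open>a \<notin> M\<close> by metis
    moreover have "J = M \<or> J = UNIV" if "semiring_ideal J" "M \<subseteq> J" for J
      using assms that unfolding maximal_ideal_def by blast
    ultimately have "?J = UNIV"
      using semiring_ideal_add_principal[OF M] add_principal_superset(1)[OF M] by meson
    then have "1 \<in> ?J" by (rule ssubst) (rule UNIV_I)
    then obtain i s where i: "i \<in> M" "1 = i + s * a" by blast
    \<comment> \<open>Multiplying the expression for \<open>1\<close> by \<open>a\<close> turns
      \<open>s * a\<close> into a multiple of \<open>a\<^sup>2\<close>, so both summands lie in
      \<open>M\<close>.\<close>
    have "a = (i + s * a) * a" using i(2) by (metis mult_1_left)
    also have "\<dots> = i * a + s * a\<^sup>2" by (simp add: algebra_simps power2_eq_square)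
    also have "\<dots> \<in> M"
      using semiring_idealD[OF M] i(1) a2 by blast
    finally show False using \<open>a \<notin> M\<close> by simp
  qed
qed

lemma max_ideals_containing_power2: "max_ideals_containing (a\<^sup>2) = max_ideals_containing a"
  by (auto simp: max_ideals_containing_def Max_spec_def maximal_ideal_power2_iff)

text \<open>Contrapositive form of the nontrivial inclusion in (ii).\<close>

lemma exists_separating_maximal_ideal:
  fixes I :: "'a::{comm_semiring_0, comm_monoid_mult} set"
  assumes compl: "\<forall>e::'a. mult_idempotent e \<longrightarrow> complemented e"
    and reg: "von_neumann_regular TYPE('a)"
    and I: "semiring_ideal I" and "a \<notin> I"
  shows "\<exists>M\<in>Max_spec. I \<subseteq> M \<and> a \<notin> M"
proof -
  obtain x where x: "a = a\<^sup>2 * x"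
    using reg unfolding von_neumann_regular_def by blast
  define e where "e = a * x"
  \<comment> \<open>Multiplying this by \<open>x\<close> gives \<open>e\<^sup>2 = e\<close>; it also
    shows that \<open>e \<in> I\<close> would force \<open>a \<in> I\<close>.\<close>
  have ea: "a = e * a"
    using x by (simp add: e_def power2_eq_square mult_ac)
  then have "e\<^sup>2 = e"
    unfolding power2_eq_square by (metis e_def mult.assoc)
  then obtain f where f: "e * f = 0" "e + f = 1"
    using compl unfolding mult_idempotent_def complemented_def by blast
  have "e \<notin> I"
    using semiring_ideal_mult_right[OF I] ea \<open>a \<notin> I\<close> by metis
  \<comment> \<open>The complement \<open>f\<close> plays the part of \<open>1 - e\<close>: a
    maximal ideal containing \<open>f\<close> cannot contain \<open>e\<close>, because
    \<open>e + f = 1\<close>, and hence cannot contain \<open>a\<close>.\<close>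
  let ?J = "{i + s * f | i s. i \<in> I}"
  have "1 \<notin> ?J"
  proof
    assume "1 \<in> ?J"
    then obtain i s where i: "i \<in> I" "1 = i + s * f" by blast
    have "e = e * (i + s * f)" using i(2) by (metis mult_1_right)
    also have "\<dots> = e * i + s * (e * f)" by (simp add: algebra_simps)
    also have "\<dots> = e * i" using f(1) by simp
    finally show False
      using semiring_ideal_mult[OF I i(1), of e] \<open>e \<notin> I\<close> by simp
  qed
  then obtain M where M: "M \<in> Max_spec" "?J \<subseteq> M"
    using exists_maximal_ideal_superset[OF semiring_ideal_add_principal[OF I]] by blast
  then have ideal: "semiring_ideal M" "M \<noteq> UNIV"
    by (auto simp: Max_spec_def maximal_ideal_def)
  have "f \<in> M" "I \<subseteq> M"
    using add_principal_superset[OF I, of f] M(2) by auto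
  moreover have "a \<notin> M"
  proof
    assume "a \<in> M"
    then have "e \<in> M"
      unfolding e_def by (rule semiring_ideal_mult_right[OF ideal(1)])
    then have "1 \<in> M"
      using semiring_ideal_add[OF ideal(1) _ \<open>f \<in> M\<close>] f(2) by metis
    then show False
      using ideal semiring_ideal_UNIV_iff by blast
  qed
  ultimately show ?thesis using M(1) by blast
qed

text \<open>Whether an element lies in a maximal ideal \<open>M\<close> can be read off from its set
  \<open>max_ideals_containing\<close>, and this carries over to intersections of such
  \<open>M\<close>. The empty family, where \<open>I = UNIV\<close>, is covered too.\<close>

lemma z_ideal_Inter_maximal:
  assumes "semiring_ideal I" and "I = \<Inter>{M \<in> Max_spec. I \<subseteq> M}"
  shows "z_ideal I"
  unfolding z_ideal_def
proof (intro conjI allI impI assms(1))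
  fix a b assume ab: "a \<in> I \<and> max_ideals_containing a = max_ideals_containing b"
  have "b \<in> M" if "M \<in> Max_spec" "I \<subseteq> M" for M
    using ab that unfolding max_ideals_containing_def by blast
  then show "b \<in> I" by (subst assms(2)) blast
qed

lemma von_neumann_regular_if_principal_z_ideals:
  assumes "\<forall>a::'a::{comm_semiring_0, comm_monoid_mult}. z_ideal (principal_ideal a)"
  shows "von_neumann_regular TYPE('a)"
  unfolding von_neumann_regular_def
proof
  fix a :: 'a
  have "a\<^sup>2 \<in> principal_ideal (a\<^sup>2)"
    unfolding principal_ideal_def mem_Collect_eq by (metis mult_1_left)
  then have "a \<in> principal_ideal (a\<^sup>2)"
    using assms max_ideals_containing_power2[of a] unfolding z_ideal_def by blast
  then show "\<exists>x. a = a\<^sup>2 * x"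
    by (auto simp: principal_ideal_def mult.commute)
qed

theorem theorem1:
  assumes "\<forall>e::'a::{comm_semiring_0, comm_monoid_mult}. mult_idempotent e \<longrightarrow> complemented e"
  shows
    "(von_neumann_regular TYPE('a) \<longleftrightarrow>
       (\<forall>I::'a set. semiring_ideal I \<longrightarrow> I = \<Inter>{M \<in> Max_spec. I \<subseteq> M})) \<and>
     ((\<forall>I::'a set. semiring_ideal I \<longrightarrow> I = \<Inter>{M \<in> Max_spec. I \<subseteq> M}) \<longleftrightarrow>
       (\<forall>I::'a set. semiring_ideal I \<longrightarrow> z_ideal I)) \<and>
     ((\<forall>I::'a set. semiring_ideal I \<longrightarrow> z_ideal I) \<longleftrightarrow>
       (\<forall>a::'a. z_ideal (principal_ideal a)))"
    (is "(?i \<longleftrightarrow> ?ii) \<and> (?ii \<longleftrightarrow> ?iii) \<and> (?iii \<longleftrightarrow> ?iv)")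
proof -
  \<comment> \<open>The equivalences follow from the cycle (i), (ii), (iii), (iv), (i).\<close>
  have ?ii if ?i
  proof (intro allI impI equalityI)
    fix I :: "'a set" assume I: "semiring_ideal I"
    show "I \<subseteq> \<Inter>{M \<in> Max_spec. I \<subseteq> M}" by blast
    show "\<Inter>{M \<in> Max_spec. I \<subseteq> M} \<subseteq> I"
      using exists_separating_maximal_ideal[OF assms that I] by blast
  qed
  moreover have "?ii \<Longrightarrow> ?iii"
    by (simp add: z_ideal_Inter_maximal)
  moreover have "?iii \<Longrightarrow> ?iv"
    using semiring_ideal_principal by blast
  moreover have "?iv \<Longrightarrow> ?i"
    by (rule von_neumann_regular_if_principal_z_ideals)
  ultimately show ?thesis by argo
qed

end
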